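(* Let $A$ be an Artinian skew left brace of finite weight and let $B=A/\operatorname{Rad}(A)$. Then $\omega(A)=\omega\big((B/B^{(2)})_{\mathrm{ab}}\big)$. In particular, if $(B/B^{(2)})_{\mathrm{ab}}$ is cyclic (for example, if $A$ is finite of square-free order), then $\omega(A)=1$.
   Context: A skew left brace is a triple $(A,+,\circ)$ where $(A,+)$ and $(A,\circ)$ are (not necessarily abelian) groups with $a\circ(b+c)=a\circ b-a+a\circ c$ for all $a,b,c\in A$. Put $\lambda_a(b)=-a+a\circ b$ and $a*b=\lambda_a(b)-b=-a+a\circ b-b$. An ideal of $A$ is a subgroup $I$ of $(A,+)$ that is normal in $(A,+)$, satisfies $\lambda_a(I)\subseteq I$ for all $a\in A$, and is a normal subgroup of $(A,\circ)$; then $A/I$ is a skew left brace. A maximal ideal is a proper ideal not contained in any other proper ideal; $\operatorname{Rad}(A)$ is the intersection of all maximal ideals of $A$ if such exist, and $A$ otherwise. The weight $\omega(A)$ of a non-zero skew left brace $A$ is the minimal number of elements of $A$ needed to generate $A$ as an ideal (a set $S$ generates $A$ as an ideal if the smallest ideal containing $S$ is $A$); by convention $\omega(0)=1$. $A$ has finite weight if it is generated as an ideal by a finite subset. $A$ is Artinian if every descending chain of ideals of $A$ is eventually stationary. $A^{(2)}$ is the additive subgroup generated by all $a*b$ with $a,b\in A$; it is an ideal. A skew left brace is trivial if its two operations coincide (equivalently $A^{(2)}=0$), and then it is just a group, whose ideals are its normal subgroups. In particular $B/B^{(2)}$ is trivial, i.e. a group, and $(B/B^{(2)})_{\mathrm{ab}}$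 denotes its abelianization, regarded as a trivial skew left brace. *)

theory Defs
  imports
    "HOL-Algebra.Ring"
    "HOL-Algebra.Elementary_Groups"
    "HOL-Computational_Algebra.Squarefree"
    "HOL-Library.Extended_Nat"
begin

text \<open>
  A triple $(A,+,\circ)$ is a record of type \<open>ring\<close>: \<open>(\<oplus>)\<close> is $+$ and \<open>(\<otimes>)\<close> is $\circ$,
  so \<open>add_monoid A\<close> is $(A,+)$ and \<open>A\<close>, viewed as a monoid record, is $(A,\circ)$.
  That the two neutral elements agree follows from the axioms (\<open>one_eq_zero\<close>).
\<close>

locale skew_left_brace =
  fixes A (structure)
  assumes add_group: "group (add_monoid A)"
    and circ_group: "group A"
    and left_compat: "\<lbrakk>a \<in> carrier A; b \<in> carrier A; c \<in> carrier A\<rbrakk>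
      \<Longrightarrow> a \<otimes> (b \<oplus> c) = (a \<otimes> b \<ominus> a) \<oplus> a \<otimes> c"

definition brace_lambda :: "('a, 'm) ring_scheme \<Rightarrow> 'a \<Rightarrow> 'a \<Rightarrow> 'a" where
  "brace_lambda A a b = \<ominus>\<^bsub>A\<^esub> a \<oplus>\<^bsub>A\<^esub> a \<otimes>\<^bsub>A\<^esub> b"

definition brace_star :: "('a, 'm) ring_scheme \<Rightarrow> 'a \<Rightarrow> 'a \<Rightarrow> 'a" where
  "brace_star A a b = brace_lambda A a b \<ominus>\<^bsub>A\<^esub> b"

definition brace_ideal :: "'a set \<Rightarrow> ('a, 'm) ring_scheme \<Rightarrow> bool" where
  "brace_ideal I A \<longleftrightarrow>
     I \<lhd> add_monoid A \<and> (\<forall>a\<in>carrier A. brace_lambda A a ` I \<subseteq> I) \<and> I \<lhd> A"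

text \<open>
  Cosets of an ideal are the same for both group structures (\<open>brace_ideal_rcos_eq\<close> below),
  hence the setwise product for \<open>\<otimes>\<close> is an operation on the additive cosets.
\<close>

definition brace_quot :: "('a, 'm) ring_scheme \<Rightarrow> 'a set \<Rightarrow> 'a set ring" where
  "brace_quot A I =
     \<lparr>carrier = rcosets\<^bsub>add_monoid A\<^esub> I, monoid.mult = set_mult A, one = I,
      zero = I, add = set_mult (add_monoid A)\<rparr>"

definition maximal_brace_ideal :: "'a set \<Rightarrow> ('a, 'm) ring_scheme \<Rightarrow> bool" where
  "maximal_brace_ideal M A \<longleftrightarrow>
     brace_ideal M A \<and> M \<noteq> carrier A \<and>
     (\<forall>J. brace_ideal J A \<and> J \<noteq> carrier A \<and> M \<subseteq> J \<longrightarrow> J = M)"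

definition brace_Rad :: "('a, 'm) ring_scheme \<Rightarrow> 'a set" where
  "brace_Rad A =
     (if \<exists>M. maximal_brace_ideal M A then \<Inter> {M. maximal_brace_ideal M A} else carrier A)"

definition brace_ideal_gen :: "('a, 'm) ring_scheme \<Rightarrow> 'a set \<Rightarrow> 'a set" where
  "brace_ideal_gen A S = \<Inter> {I. brace_ideal I A \<and> S \<subseteq> I}"

definition brace_finite_weight :: "('a, 'm) ring_scheme \<Rightarrow> bool" where
  "brace_finite_weight A \<longleftrightarrow>
     (\<exists>S. finite S \<and> S \<subseteq> carrier A \<and> brace_ideal_gen A S = carrier A)"

text \<open>The infimum is \<open>\<infinity>\<close> exactly when no finite set generates \<open>A\<close> as an ideal.\<close>

definition brace_weight :: "('a, 'm) ring_scheme \<Rightarrow> enat" where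
  "brace_weight A =
     (if carrier A = {\<zero>\<^bsub>A\<^esub>} then 1
      else Inf {enat (card S) |S. finite S \<and> S \<subseteq> carrier A \<and> brace_ideal_gen A S = carrier A})"

definition brace_Artinian :: "('a, 'm) ring_scheme \<Rightarrow> bool" where
  "brace_Artinian A \<longleftrightarrow>
     (\<forall>I :: nat \<Rightarrow> 'a set. (\<forall>n. brace_ideal (I n) A) \<and> (\<forall>n. I (Suc n) \<subseteq> I n)
        \<longrightarrow> (\<exists>N. \<forall>n\<ge>N. I n = I N))"

definition brace_square :: "('a, 'm) ring_scheme \<Rightarrow> 'a set" where
  "brace_square A =
     generate (add_monoid A) {brace_star A a b |a b. a \<in> carrier A \<and> b \<in> carrier A}"

definition trivial_brace :: "('a, 'm) monoid_scheme \<Rightarrow> 'a ring" where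
  "trivial_brace G =
     \<lparr>carrier = carrier G, monoid.mult = monoid.mult G, one = one G,
      zero = one G, add = monoid.mult G\<rparr>"

definition abelianization :: "('a, 'm) monoid_scheme \<Rightarrow> 'a set monoid" where
  "abelianization G = G Mod derived G (carrier G)"

text \<open>
  The group $(B/B^{(2)})_{\mathrm{ab}}$. The two operations of $B/B^{(2)}$ coincide; the
  additive one is used.
\<close>

definition brace_top_ab :: "('a, 'm) ring_scheme \<Rightarrow> 'a set set monoid" where
  "brace_top_ab B = abelianization (add_monoid (brace_quot B (brace_square B)))"

context skew_left_brace
begin

interpretation add: group "add_monoid A"
  rewrites "carrier (add_monoid A) = carrier A"
    and "monoid.mult (add_monoid A) = add A"
    and "one (add_monoid A) = zero A"
    and "m_inv (add_monoid A) = a_inv A"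
  by (rule add_group) (simp_all add: a_inv_def)

interpretation circ: group A
  by (rule circ_group)

lemma one_eq_zero: "\<one> = \<zero>"
proof -
  have "\<one> \<otimes> (\<zero> \<oplus> \<zero>) = (\<one> \<otimes> \<zero> \<ominus> \<one>) \<oplus> \<one> \<otimes> \<zero>"
    by (rule left_compat) auto
  then have "\<zero> = \<ominus> \<one>"
    by (simp add: a_minus_def)
  then show ?thesis
    by (metis add.inv_inv add.inv_one circ.one_closed)
qed

lemma lambda_closed:
  "\<lbrakk>a \<in> carrier A; b \<in> carrier A\<rbrakk> \<Longrightarrow> brace_lambda A a b \<in> carrier A"
  by (simp add: brace_lambda_def)

lemma circ_eq: "\<lbrakk>a \<in> carrier A; b \<in> carrier A\<rbrakk> \<Longrightarrow> a \<otimes> b = a \<oplus> brace_lambda A a b"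
  by (simp add: brace_lambda_def flip: add.m_assoc)

lemma lambda_add:
  assumes "a \<in> carrier A" "b \<in> carrier A" "c \<in> carrier A"
  shows "brace_lambda A a (b \<oplus> c) = brace_lambda A a b \<oplus> brace_lambda A a c"
  using assms by (simp add: brace_lambda_def left_compat a_minus_def add.m_assoc)

lemma lambda_circ:
  assumes "a \<in> carrier A" "b \<in> carrier A" "c \<in> carrier A"
  shows "brace_lambda A (a \<otimes> b) c = brace_lambda A a (brace_lambda A b c)"
proof -
  have "(a \<otimes> b) \<oplus> brace_lambda A (a \<otimes> b) c = a \<otimes> (b \<otimes> c)"
    using assms by (simp add: circ.m_assoc flip: circ_eq)
  also have "\<dots> = a \<oplus> brace_lambda A a (b \<oplus> brace_lambda A b c)"
    using assms by (simp add: circ_eq lambda_closed)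
  also have "\<dots> = (a \<otimes> b) \<oplus> brace_lambda A a (brace_lambda A b c)"
    using assms by (simp add: lambda_add lambda_closed circ_eq add.m_assoc)
  finally show ?thesis
    using assms by (simp add: lambda_closed)
qed

lemma lambda_one: "b \<in> carrier A \<Longrightarrow> brace_lambda A \<one> b = b"
  by (simp add: brace_lambda_def) (simp add: one_eq_zero)

lemma brace_ideal_rcos_eq:
  assumes "brace_ideal I A" "a \<in> carrier A"
  shows "I #>\<^bsub>add_monoid A\<^esub> a = I #> a"
proof -
  interpret aI: normal I "add_monoid A"
    using assms(1) by (simp add: brace_ideal_def)
  interpret cI: normal I A
    using assms(1) by (simp add: brace_ideal_def)
  have lam: "brace_lambda A x i \<in> I" if "x \<in> carrier A" "i \<in> I" for x i
    using assms(1) that unfolding brace_ideal_def by blast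
  have sub: "i \<in> carrier A" if "i \<in> I" for i
    using that cI.subset by blast
  have "I #>\<^bsub>add_monoid A\<^esub> a = a <#\<^bsub>add_monoid A\<^esub> I"
    using aI.coset_eq assms(2) by simp
  also have "\<dots> = a <# I"
  proof
    show "a <# I \<subseteq> a <#\<^bsub>add_monoid A\<^esub> I"
      using assms(2) sub lam by (auto simp: l_coset_def circ_eq)
  next
    have "a \<oplus> i = a \<otimes> brace_lambda A (inv a) i" if "i \<in> I" for i
    proof -
      have "brace_lambda A a (brace_lambda A (inv a) i) = i"
        using that assms(2) sub lambda_circ[of a "inv a" i] by (simp add: lambda_one)
      then show ?thesis
        using that assms(2) sub by (simp add: circ_eq lambda_closed)
    qed
    then show "a <#\<^bsub>add_monoid A\<^esub> I \<subseteq> a <# I"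
      using assms(2) lam by (auto simp: l_coset_def)
  qed
  also have "\<dots> = I #> a"
    using cI.coset_eq assms(2) by simp
  finally show ?thesis .
qed

lemma brace_ideal_rcosets_eq:
  assumes "brace_ideal I A"
  shows "rcosets\<^bsub>add_monoid A\<^esub> I = rcosets I"
  using brace_ideal_rcos_eq[OF assms] by (simp add: RCOSETS_def)

lemma skew_left_brace_quot:
  assumes "brace_ideal I A"
  shows "skew_left_brace (brace_quot A I)"
proof -
  interpret aI: normal I "add_monoid A"
    using assms by (simp add: brace_ideal_def)
  interpret cI: normal I A
    using assms by (simp add: brace_ideal_def)
  let ?Q = "brace_quot A I"
  have Qa: "add_monoid ?Q = add_monoid A Mod I"
    by (simp add: brace_quot_def FactGroup_def)
  have gQa: "group (add_monoid ?Q)"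
    unfolding Qa by (rule aI.factorgroup_is_group)
  have gQ: "group ?Q"
    using cI.factorgroup_is_group
    by (simp add: brace_quot_def FactGroup_def brace_ideal_rcosets_eq[OF assms]
        group_def monoid_def group_axioms_def Units_def)
  note req = brace_ideal_rcos_eq[OF assms]
  let ?c = "\<lambda>a. I #>\<^bsub>add_monoid A\<^esub> a"
  have ad: "?c a \<oplus>\<^bsub>?Q\<^esub> ?c b = ?c (a \<oplus> b)" if "a \<in> carrier A" "b \<in> carrier A" for a b
    using that aI.rcos_sum by (simp add: brace_quot_def)
  have mu: "?c a \<otimes>\<^bsub>?Q\<^esub> ?c b = ?c (a \<otimes> b)" if "a \<in> carrier A" "b \<in> carrier A" for a b
    using that cI.rcos_sum by (simp add: brace_quot_def req)
  have cQ: "carrier ?Q = ?c ` carrier A"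
    by (auto simp: brace_quot_def RCOSETS_def)
  have mi: "\<ominus>\<^bsub>?Q\<^esub> ?c a = ?c (\<ominus> a)" if "a \<in> carrier A" for a
    using that aI.inv_FactGroup[of "?c a"] aI.rcos_inv[of a]
    unfolding a_inv_def Qa by (auto simp: FactGroup_def RCOSETS_def)
  show ?thesis
  proof (rule skew_left_brace.intro)
    fix x y z
    assume "x \<in> carrier ?Q" "y \<in> carrier ?Q" "z \<in> carrier ?Q"
    then obtain a b c where abc: "a \<in> carrier A" "b \<in> carrier A" "c \<in> carrier A"
      and "x = ?c a" "y = ?c b" "z = ?c c"
      unfolding cQ by blast
    then show "x \<otimes>\<^bsub>?Q\<^esub> (y \<oplus>\<^bsub>?Q\<^esub> z) = (x \<otimes>\<^bsub>?Q\<^esub> y \<ominus>\<^bsub>?Q\<^esub> x) \<oplus>\<^bsub>?Q\<^esub> x \<otimes>\<^bsub>?Q\<^esub> z"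
      by (simp add: ad mu mi a_minus_def left_compat)
  qed (fact gQa gQ)+
qed

end

lemma skew_left_brace_trivial_brace:
  assumes "group G"
  shows "skew_left_brace (trivial_brace G)"
proof -
  interpret group G by fact
  have 1: "group (trivial_brace G)"
    by (rule groupI) (auto simp: trivial_brace_def m_assoc l_inv_ex)
  have 2: "group (add_monoid (trivial_brace G))"
    by (rule groupI) (auto simp: trivial_brace_def m_assoc l_inv_ex)
  have 3: "\<ominus>\<^bsub>trivial_brace G\<^esub> a = inv\<^bsub>G\<^esub> a" for a
    by (simp add: a_inv_def m_inv_def trivial_brace_def)
  show ?thesis
  proof (rule skew_left_brace.intro)
    fix a b c
    assume "a \<in> carrier (trivial_brace G)" "b \<in> carrier (trivial_brace G)"
      "c \<in> carrier (trivial_brace G)"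
    then have abc: "a \<in> carrier G" "b \<in> carrier G" "c \<in> carrier G"
      by (simp_all add: trivial_brace_def)
    then have "inv\<^bsub>G\<^esub> a \<otimes>\<^bsub>G\<^esub> (a \<otimes>\<^bsub>G\<^esub> c) = c"
      by (simp flip: m_assoc)
    with abc show "a \<otimes>\<^bsub>trivial_brace G\<^esub> (b \<oplus>\<^bsub>trivial_brace G\<^esub> c) =
        (a \<otimes>\<^bsub>trivial_brace G\<^esub> b \<ominus>\<^bsub>trivial_brace G\<^esub> a) \<oplus>\<^bsub>trivial_brace G\<^esub>
        a \<otimes>\<^bsub>trivial_brace G\<^esub> c"
      unfolding a_minus_def 3 by (simp add: trivial_brace_def m_assoc)
  qed (fact 1 2)+
qed

end

(*
  Call a maximal ideal M commutative if A/M is an abelian group with both operations equal. If M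
  is not commutative, then it is prime for intersections: were I and J ideals with I \<inter> J \<subseteq> M
  and I + M = A = J + M, all additive commutators and all a * b would be congruent mod M to elements
  of I \<inter> J. By the Artinian property there are therefore only finitely many noncommutative
  maximal ideals.

  The kernel E of A \<longrightarrow> G = (B/B^(2))_ab lies in every commutative maximal ideal but in no
  noncommutative one. Given generators of G, lift them to A arbitrarily and move one lift by an
  element of E out of all the noncommutative maximal ideals (prime avoidance). The lifts then lie in
  no maximal ideal, and since A has finite weight, Zorn's lemma shows that they generate A.

  For square-free order, G is a finite abelian group of square-free order: an element of maximal
  order can be multiplied by an element of any missing prime order, so it generates G.
*)
theory Submission
  imports Defs "HOL-Algebra.Sylow" "HOL-Algebra.Multiplicative_Group"
begin

section \<open>Element orders and cyclicity in abelian groups; commutators in factor groups\<close>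

section \<open>Groups\<close>

text \<open>Since \<open>x = (x \<otimes> y) \<otimes> inv y\<close>, \<open>ord x\<close> divides
  \<open>ord (x \<otimes> y) * ord y\<close>, and coprimality removes the second factor; likewise
  for \<open>y\<close>.\<close>

lemma (in comm_group) ord_mult_coprime:
  assumes "x \<in> carrier G" "y \<in> carrier G" "coprime (ord x) (ord y)"
  shows "ord (x \<otimes> y) = ord x * ord y"
proof (rule dvd_antisym)
  show "ord (x \<otimes> y) dvd ord x * ord y"
    using assms by (simp add: abelian_ord_mul_divides)
  have x: "ord x dvd ord (x \<otimes> y)"
  proof -
    have "x = (x \<otimes> y) \<otimes> inv y"
      using assms by (simp add: m_assoc)
    then have "ord x dvd ord (x \<otimes> y) * ord y"
      using assms abelian_ord_mul_divides[of "x \<otimes> y" "inv y"] by simp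
    then show ?thesis
      using assms(3) by (simp add: coprime_dvd_mult_left_iff)
  qed
  have y: "ord y dvd ord (x \<otimes> y)"
  proof -
    have "y = (x \<otimes> y) \<otimes> inv x"
      using assms m_comm[of x y] by (simp add: m_assoc)
    then have "ord y dvd ord (x \<otimes> y) * ord x"
      using assms abelian_ord_mul_divides[of "x \<otimes> y" "inv x"] by simp
    then show ?thesis
      using assms(3) by (simp add: coprime_dvd_mult_left_iff coprime_commute)
  qed
  show "ord x * ord y dvd ord (x \<otimes> y)"
    using x y assms(3) by (simp add: divides_mult)
qed

text \<open>Cauchy's theorem, read off from Sylow's theorem with exponent 1: in a subgroup of prime
  order \<open>p\<close> every element other than the identity has order \<open>p\<close>.\<close>

lemma (in group) exists_ord_prime:
  assumes "finite (carrier G)" "prime p" "p dvd order G"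
  shows "\<exists>y\<in>carrier G. ord y = p"
proof -
  obtain m where "order G = p ^ 1 * m"
    using assms(3) by auto
  then obtain H where H: "subgroup H G" "card H = p"
    using sylow_thm[OF assms(2) is_group _ assms(1), of 1 m] by auto
  have "H \<noteq> {\<one>}"
    using H(2) assms(2) by auto
  then obtain y where y: "y \<in> H" "y \<noteq> \<one>"
    using subgroup.one_closed[OF H(1)] by blast
  then have yG: "y \<in> carrier G"
    using subgroup.mem_carrier[OF H(1)] by blast
  interpret HG: group "G\<lparr>carrier := H\<rparr>"
    using subgroup_imp_group[OF H(1)] .
  have "y [^]\<^bsub>G\<lparr>carrier := H\<rparr>\<^esub> order (G\<lparr>carrier := H\<rparr>) = \<one>\<^bsub>G\<lparr>carrier := H\<rparr>\<^esub>"
    using y by (intro HG.pow_order_eq_1) simp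
  then have "y [^] p = \<one>"
    using H(2) by (simp add: order_def nat_pow_def)
  then have "ord y dvd p"
    using pow_eq_id yG by simp
  moreover have "ord y \<noteq> 1"
    using ord_eq_1 yG y(2) by simp
  ultimately show ?thesis
    using assms(2) yG prime_nat_iff by blast
qed

lemma (in comm_group) cyclic_group_if_squarefree_order:
  assumes "finite (carrier G)" "squarefree (order G)"
  shows "cyclic_group G"
proof -
  obtain a where a: "a \<in> carrier G" and max: "\<And>x. x \<in> carrier G \<Longrightarrow> ord x \<le> ord a"
    using one_closed assms(1) Max_in[of "ord ` carrier G"] Max_ge[of "ord ` carrier G"] by fastforce
  have pos: "order G > 0"
    using assms(1) order_gt_0_iff_finite by simp
  obtain k where k: "order G = ord a * k"
    using ord_dvd_group_order[OF a] by blast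
  have "k = 1"
  proof (rule ccontr)
    assume "k \<noteq> 1"
    then obtain p where p: "prime p" "p dvd k"
      using prime_factor_nat by blast
    \<comment> \<open>The factor \<open>k\<close> is the index of the subgroup generated by
      \<open>a\<close>; a prime dividing both \<open>k\<close> and \<open>ord a\<close> would divide
      the group order twice.\<close>
    have "\<not> p dvd ord a"
    proof
      assume "p dvd ord a"
      with p(2) have "p\<^sup>2 dvd order G"
        unfolding k power2_eq_square by (rule mult_dvd_mono[rotated])
      then show False
        using assms(2) p(1) unfolding squarefree_def by (metis not_prime_unit)
    qed
    then have cop: "coprime (ord a) p"
      using p(1) by (simp add: prime_imp_coprime coprime_commute)
    obtain y where y: "y \<in> carrier G" "ord y = p"
      using exists_ord_prime[OF assms(1) p(1)] p(2) k by auto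
    have "ord (a \<otimes> y) = ord a * p"
      using ord_mult_coprime[OF a y(1)] cop y(2) by simp
    then have "ord a * p \<le> ord a"
      using max[of "a \<otimes> y"] a y by simp
    moreover have "ord a > 0"
      using pos k by (cases "ord a = 0") auto
    ultimately show False
      using prime_gt_1_nat[OF p(1)] by simp
  qed
  then have "card (generate G {a}) = card (carrier G)"
    using k generate_pow_card[OF a] by (simp add: order_def)
  then have "generate G {a} = carrier G"
    using assms(1) generate_in_carrier[of "{a}"] a by (intro card_subset_eq) auto
  then show ?thesis
    unfolding cyclic_group_def using a by (intro bexI[of _ a]) (simp_all add: subgroup_generated_def)
qed

text \<open>Conjugation by \<open>g\<close> is an automorphism, so it is enough to check generators.
  Their conjugates may lie anywhere in the generated subgroup, not only in \<open>H\<close>; this is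
  the form available for star products.\<close>

lemma (in group) normal_generate_if_conj_mem:
  assumes "H \<subseteq> carrier G"
    and conj: "\<And>h g. \<lbrakk>h \<in> H; g \<in> carrier G\<rbrakk> \<Longrightarrow> g \<otimes> h \<otimes> inv g \<in> generate G H"
  shows "generate G H \<lhd> G"
proof (rule normal_invI[OF generate_is_subgroup[OF assms(1)]])
  fix x g assume "x \<in> generate G H" and g: "g \<in> carrier G"
  note S = generate_is_subgroup[OF assms(1)]
  show "g \<otimes> x \<otimes> inv g \<in> generate G H"
    using \<open>x \<in> generate G H\<close>
  proof (induction x rule: generate.induct)
    case one
    then show ?case
      using g generate.one by simp
  next
    case (incl h)
    then show ?case
      using conj g by blast
  next
    case (inv h)
    then have "h \<in> carrier G"
      using assms(1) by blast
    then have "g \<otimes> inv h \<otimes> inv g = inv (g \<otimes> h \<otimes> inv g)"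
      using g by (simp add: inv_mult_group m_assoc)
    then show ?case
      using subgroup.m_inv_closed[OF S conj[OF inv g]] by simp
  next
    case (eng h k)
    then have "h \<in> carrier G" "k \<in> carrier G"
      using generate_in_carrier[OF assms(1)] by auto
    moreover from this have "inv g \<otimes> (g \<otimes> (k \<otimes> inv g)) = k \<otimes> inv g"
      using g by (simp flip: m_assoc)
    ultimately have "g \<otimes> (h \<otimes> k) \<otimes> inv g = (g \<otimes> h \<otimes> inv g) \<otimes> (g \<otimes> k \<otimes> inv g)"
      using g by (simp add: m_assoc)
    then show ?case
      using generate.eng[OF eng.IH] by simp
  qed
qed

text \<open>A subgroup containing \<open>H\<close> is a union of cosets of \<open>H\<close>, hence
  the full preimage of its image in the factor group.\<close>

lemma (in normal) mem_if_rcos_mem_image: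
  assumes "subgroup M G" "H \<subseteq> M" "x \<in> carrier G" "H #> x \<in> (\<lambda>m. H #> m) ` M"
  shows "x \<in> M"
proof -
  obtain m where m: "m \<in> M" "H #> x = H #> m"
    using assms(4) by blast
  then have "x \<in> H #> m"
    using rcos_self[OF assms(3) is_subgroup] by simp
  then show ?thesis
    using assms(2) m(1) subgroup.m_closed[OF assms(1)] by (auto simp: r_coset_def)
qed

text \<open>The image of \<open>M\<close> is a subgroup of the factor group, and every commutator
  there is the coset of a commutator of representatives.\<close>

lemma (in normal) derived_FactGroup_subset:
  assumes M: "subgroup M G"
    and comm: "\<And>x y. \<lbrakk>x \<in> carrier G; y \<in> carrier G\<rbrakk> \<Longrightarrow> x \<otimes> y \<otimes> inv x \<otimes> inv y \<in> M"
  shows "derived (G Mod H) (carrier (G Mod H)) \<subseteq> (\<lambda>m. H #> m) ` M"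
proof -
  interpret Q: group "G Mod H"
    by (rule factorgroup_is_group)
  interpret q: group_hom G "G Mod H" "\<lambda>a. H #> a"
    by unfold_locales (rule r_coset_hom_Mod)
  have sub: "subgroup ((\<lambda>m. H #> m) ` M) (G Mod H)"
    by (rule q.subgroup_img_is_subgroup[OF M])
  show ?thesis
    unfolding derived_def
  proof (rule Q.generate_subgroup_incl[OF _ sub], clarify)
    fix X Y assume "X \<in> carrier (G Mod H)" "Y \<in> carrier (G Mod H)"
    then obtain x y where xy: "x \<in> carrier G" "y \<in> carrier G" "X = H #> x" "Y = H #> y"
      by (auto simp: carrier_FactGroup)
    then have "X \<otimes>\<^bsub>G Mod H\<^esub> Y \<otimes>\<^bsub>G Mod H\<^esub> inv\<^bsub>G Mod H\<^esub> X \<otimes>\<^bsub>G Mod H\<^esub> inv\<^bsub>G Mod H\<^esub> Y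
        = H #> (x \<otimes> y \<otimes> inv x \<otimes> inv y)"
      by (simp only: q.hom_mult q.hom_inv m_closed inv_closed)
    then show "X \<otimes>\<^bsub>G Mod H\<^esub> Y \<otimes>\<^bsub>G Mod H\<^esub> inv\<^bsub>G Mod H\<^esub> X \<otimes>\<^bsub>G Mod H\<^esub> inv\<^bsub>G Mod H\<^esub> Y
        \<in> (\<lambda>m. H #> m) ` M"
      using comm[OF xy(1,2)] by (metis imageI)
  qed
qed

section \<open>Ideals of skew left braces\<close>

text \<open>For an ideal \<open>M\<close> this says that the quotient by \<open>M\<close> is a
  trivial brace on an abelian group. The elementwise form makes sense for any set and passes to
  supersets, so an ideal with this property cannot lie in a noncommutative maximal ideal.\<close>

definition commutative_modulo :: "('a, 'm) ring_scheme \<Rightarrow> 'a set \<Rightarrow> bool" where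
  "commutative_modulo A M \<longleftrightarrow> (\<forall>a\<in>carrier A. \<forall>b\<in>carrier A.
     brace_star A a b \<in> M \<and> a \<oplus>\<^bsub>A\<^esub> b \<oplus>\<^bsub>A\<^esub> \<ominus>\<^bsub>A\<^esub> a \<oplus>\<^bsub>A\<^esub> \<ominus>\<^bsub>A\<^esub> b \<in> M)"

context skew_left_brace
begin

interpretation add: group "add_monoid A"
  rewrites "carrier (add_monoid A) = carrier A"
    and "monoid.mult (add_monoid A) = add A"
    and "one (add_monoid A) = zero A"
    and "m_inv (add_monoid A) = a_inv A"
  by (rule add_group) (simp_all add: a_inv_def)

interpretation circ: group A
  by (rule circ_group)

section \<open>Criteria for ideals, and the coset operations of the quotient\<close>

lemma add_cancel_simps:
  assumes "x \<in> carrier A" "y \<in> carrier A"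
  shows "\<ominus> x \<oplus> (x \<oplus> y) = y" "x \<oplus> (\<ominus> x \<oplus> y) = y"
    "inv x \<otimes> (x \<otimes> y) = y" "x \<otimes> (inv x \<otimes> y) = y"
  using assms by (simp_all flip: add.m_assoc circ.m_assoc)

text \<open>Closure under \<open>\<otimes>\<close> and its inverse follows from the additive and
  \<open>brace_lambda\<close> conditions:
  \<open>x \<otimes> y = x \<oplus> brace_lambda A x y\<close> and
  \<open>inv x = \<ominus> brace_lambda A (inv x) x\<close>.\<close>

lemma brace_idealI:
  assumes sub: "I \<subseteq> carrier A" and zero: "\<zero> \<in> I"
    and plus: "\<And>x y. \<lbrakk>x \<in> I; y \<in> I\<rbrakk> \<Longrightarrow> x \<oplus> y \<in> I"
    and minus: "\<And>x. x \<in> I \<Longrightarrow> \<ominus> x \<in> I"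
    and conj: "\<And>a x. \<lbrakk>a \<in> carrier A; x \<in> I\<rbrakk> \<Longrightarrow> a \<oplus> x \<oplus> \<ominus> a \<in> I"
    and lam: "\<And>a x. \<lbrakk>a \<in> carrier A; x \<in> I\<rbrakk> \<Longrightarrow> brace_lambda A a x \<in> I"
    and cconj: "\<And>a x. \<lbrakk>a \<in> carrier A; x \<in> I\<rbrakk> \<Longrightarrow> a \<otimes> x \<otimes> inv a \<in> I"
  shows "brace_ideal I A"
  unfolding brace_ideal_def
proof (intro conjI)
  have "subgroup I (add_monoid A)"
    by (rule add.subgroupI) (use sub zero plus minus in auto)
  then show "I \<lhd> add_monoid A"
    using conj by (simp add: add.normal_inv_iff)
  have "subgroup I A"
  proof (rule circ.subgroupI)
    show "I \<subseteq> carrier A" "I \<noteq> {}"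
      using sub zero by auto
    fix x y assume xy: "x \<in> I" "y \<in> I"
    then show "x \<otimes> y \<in> I"
      using sub circ_eq[of x y] lam[of x y] plus by (metis subsetD)
    have "\<ominus> brace_lambda A (inv x) x = inv x"
      using xy(1) sub by (auto simp: brace_lambda_def one_eq_zero)
    then show "inv x \<in> I"
      using xy(1) sub lam[of "inv x" x] minus by fastforce
  qed
  then show "I \<lhd> A"
    using cconj by (simp add: circ.normal_inv_iff)
qed (use lam in auto)

context
  fixes I
  assumes I: "brace_ideal I A"
begin

lemma add_normal: "I \<lhd> add_monoid A" and circ_normal: "I \<lhd> A"
  using I by (simp_all add: brace_ideal_def)

lemma ideal_add_subgroup: "subgroup I (add_monoid A)"
  using add_normal by (rule normal_imp_subgroup)

lemma ideal_subset: "I \<subseteq> carrier A"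
  using subgroup.subset[OF ideal_add_subgroup] by simp

lemma ideal_zero: "\<zero> \<in> I"
  using subgroup.one_closed[OF ideal_add_subgroup] by simp

lemma ideal_add: "\<lbrakk>x \<in> I; y \<in> I\<rbrakk> \<Longrightarrow> x \<oplus> y \<in> I"
  using subgroup.m_closed[OF ideal_add_subgroup] by simp

lemma ideal_minus: "x \<in> I \<Longrightarrow> \<ominus> x \<in> I"
  using subgroup.m_inv_closed[OF ideal_add_subgroup] by (simp add: a_inv_def)

lemma ideal_add_conj: "\<lbrakk>a \<in> carrier A; x \<in> I\<rbrakk> \<Longrightarrow> a \<oplus> x \<oplus> \<ominus> a \<in> I"
  using normal.inv_op_closed2[OF add_normal] by (simp add: a_inv_def)

lemma ideal_lambda: "\<lbrakk>a \<in> carrier A; x \<in> I\<rbrakk> \<Longrightarrow> brace_lambda A a x \<in> I"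
  using I by (auto simp: brace_ideal_def)

lemma ideal_circ_conj: "\<lbrakk>a \<in> carrier A; x \<in> I\<rbrakk> \<Longrightarrow> a \<otimes> x \<otimes> inv a \<in> I"
  using normal.inv_op_closed2[OF circ_normal] by simp

lemma ideal_rcos_eq_iff: "x \<in> carrier A \<Longrightarrow> I #>\<^bsub>add_monoid A\<^esub> x = I \<longleftrightarrow> x \<in> I"
  using add.coset_join1[OF _ _ ideal_add_subgroup] add.coset_join2[OF _ ideal_add_subgroup] by blast

lemma carrier_quot: "carrier (brace_quot A I) = (\<lambda>x. I #>\<^bsub>add_monoid A\<^esub> x) ` carrier A"
  by (auto simp: brace_quot_def RCOSETS_def)

lemma add_monoid_quot: "add_monoid (brace_quot A I) = add_monoid A Mod I"
  by (simp add: brace_quot_def FactGroup_def)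

lemma quot_add:
  assumes "x \<in> carrier A" "y \<in> carrier A"
  shows "(I #>\<^bsub>add_monoid A\<^esub> x) \<oplus>\<^bsub>brace_quot A I\<^esub> (I #>\<^bsub>add_monoid A\<^esub> y)
    = I #>\<^bsub>add_monoid A\<^esub> (x \<oplus> y)"
  using normal.rcos_sum[OF add_normal] assms by (simp add: brace_quot_def)

lemma quot_mult:
  assumes "x \<in> carrier A" "y \<in> carrier A"
  shows "(I #>\<^bsub>add_monoid A\<^esub> x) \<otimes>\<^bsub>brace_quot A I\<^esub> (I #>\<^bsub>add_monoid A\<^esub> y)
    = I #>\<^bsub>add_monoid A\<^esub> (x \<otimes> y)"
  using normal.rcos_sum[OF circ_normal] assms by (simp add: brace_quot_def brace_ideal_rcos_eq[OF I])

lemma quot_minus: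
  assumes "x \<in> carrier A"
  shows "\<ominus>\<^bsub>brace_quot A I\<^esub> (I #>\<^bsub>add_monoid A\<^esub> x) = I #>\<^bsub>add_monoid A\<^esub> (\<ominus> x)"
  using assms normal.inv_FactGroup[OF add_normal, of "I #>\<^bsub>add_monoid A\<^esub> x"]
    normal.rcos_inv[OF add_normal, of x]
  unfolding a_inv_def add_monoid_quot by (auto simp: FactGroup_def RCOSETS_def)

lemma quot_star:
  assumes "x \<in> carrier A" "y \<in> carrier A"
  shows "brace_star (brace_quot A I) (I #>\<^bsub>add_monoid A\<^esub> x) (I #>\<^bsub>add_monoid A\<^esub> y)
    = I #>\<^bsub>add_monoid A\<^esub> (brace_star A x y)"
  using assms by (simp add: brace_star_def brace_lambda_def a_minus_def quot_add quot_mult quot_minus)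

end

section \<open>Star products and their absorption by ideals\<close>

lemma star_closed: "\<lbrakk>a \<in> carrier A; b \<in> carrier A\<rbrakk> \<Longrightarrow> brace_star A a b \<in> carrier A"
  by (simp add: brace_star_def lambda_closed a_minus_def)

text \<open>The star product is the defect between the two operations, so an additive map that kills
  all star products also respects \<open>\<otimes>\<close>.\<close>

lemma circ_eq_star:
  "\<lbrakk>a \<in> carrier A; b \<in> carrier A\<rbrakk> \<Longrightarrow> a \<otimes> b = a \<oplus> brace_star A a b \<oplus> b"
  by (simp add: circ_eq brace_star_def lambda_closed a_minus_def add.m_assoc)

lemma star_mem_right:
  assumes "brace_ideal I A" "a \<in> carrier A" "x \<in> I"
  shows "brace_star A a x \<in> I"
  using assms ideal_lambda ideal_add ideal_minus by (simp add: brace_star_def a_minus_def)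

text \<open>Normality in the circle group gives \<open>x \<otimes> b = b \<otimes> y\<close> with
  \<open>y\<close> in \<open>I\<close>. Expanding the right side as
  \<open>b \<oplus> brace_lambda A b y\<close> shows that the star product is
  \<open>\<ominus> x\<close> plus an additive conjugate of an element of \<open>I\<close>.\<close>

lemma star_mem_left:
  assumes I: "brace_ideal I A" and x: "x \<in> I" and b: "b \<in> carrier A"
  shows "brace_star A x b \<in> I"
proof -
  have xA: "x \<in> carrier A"
    using x ideal_subset[OF I] by blast
  define y where "y = inv b \<otimes> x \<otimes> b"
  have y: "y \<in> I" "y \<in> carrier A"
    using ideal_circ_conj[OF I, of "inv b" x] x b xA unfolding y_def by simp_all
  have l: "brace_lambda A b y \<in> I" "brace_lambda A b y \<in> carrier A"
    using ideal_lambda[OF I b y(1)] ideal_subset[OF I] by auto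
  have "x \<otimes> b = b \<otimes> y"
    using xA b by (simp add: y_def flip: circ.m_assoc)
  also have "\<dots> = b \<oplus> brace_lambda A b y"
    using b y by (simp add: circ_eq)
  finally have "brace_star A x b = \<ominus> x \<oplus> (b \<oplus> brace_lambda A b y \<oplus> \<ominus> b)"
    using xA b l by (simp add: brace_star_def brace_lambda_def a_minus_def add.m_assoc)
  then show ?thesis
    using ideal_add[OF I ideal_minus[OF I x] ideal_add_conj[OF I b l(1)]] by simp
qed

section \<open>Intersections, unions of chains, sums and generation of ideals\<close>

lemma brace_ideal_carrier: "brace_ideal (carrier A) A"
  by (rule brace_idealI) (auto simp: lambda_closed)

lemma brace_ideal_Inter:
  assumes "\<I> \<noteq> {}" "\<And>I. I \<in> \<I> \<Longrightarrow> brace_ideal I A"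
  shows "brace_ideal (\<Inter>\<I>) A"
proof (rule brace_idealI)
  show "\<Inter>\<I> \<subseteq> carrier A"
    using assms ideal_subset by blast
qed (use assms(2) in \<open>auto intro: ideal_zero ideal_add ideal_minus ideal_add_conj ideal_lambda ideal_circ_conj\<close>)

lemma brace_ideal_Union_chain:
  assumes "\<I> \<noteq> {}" "\<And>I. I \<in> \<I> \<Longrightarrow> brace_ideal I A"
    and chain: "\<And>I J. \<lbrakk>I \<in> \<I>; J \<in> \<I>\<rbrakk> \<Longrightarrow> I \<subseteq> J \<or> J \<subseteq> I"
  shows "brace_ideal (\<Union>\<I>) A"
proof (rule brace_idealI)
  show "\<Union>\<I> \<subseteq> carrier A" "\<zero> \<in> \<Union>\<I>"
    using assms ideal_subset ideal_zero by blast+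
  fix x y assume "x \<in> \<Union>\<I>" "y \<in> \<Union>\<I>"
  then obtain I where "I \<in> \<I>" "x \<in> I" "y \<in> I"
    using chain by blast
  then show "x \<oplus> y \<in> \<Union>\<I>"
    using ideal_add[OF assms(2)] by blast
next
  fix x assume "x \<in> \<Union>\<I>"
  then obtain I where I: "I \<in> \<I>" "x \<in> I"
    by blast
  show "\<ominus> x \<in> \<Union>\<I>"
    using ideal_minus[OF assms(2)] I by blast
  fix a assume "a \<in> carrier A"
  with I show "a \<oplus> x \<oplus> \<ominus> a \<in> \<Union>\<I>" "brace_lambda A a x \<in> \<Union>\<I>" "a \<otimes> x \<otimes> inv a \<in> \<Union>\<I>"
    using ideal_add_conj[OF assms(2)] ideal_lambda[OF assms(2)] ideal_circ_conj[OF assms(2)]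
    by (meson UnionI)+
qed

lemma brace_ideal_set_add:
  assumes I: "brace_ideal I A" and J: "brace_ideal J A"
  shows "brace_ideal {i \<oplus> j |i j. i \<in> I \<and> j \<in> J} A" (is "brace_ideal ?S A")
proof (rule brace_idealI)
  note c = subsetD[OF ideal_subset[OF I]] subsetD[OF ideal_subset[OF J]]
  show "?S \<subseteq> carrier A"
    using c by auto
  show "\<zero> \<in> ?S"
    using ideal_zero[OF I] ideal_zero[OF J] by force
  fix x assume "x \<in> ?S"
  then obtain i j where x: "x = i \<oplus> j" and ij: "i \<in> I" "j \<in> J"
    by blast
  {
    fix y assume "y \<in> ?S"
    then obtain i' j' where y: "y = i' \<oplus> j'" and ij': "i' \<in> I" "j' \<in> J"
      by blast
    \<comment> \<open>Moving \<open>i'\<close> to the left of \<open>j\<close> costs an additive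
      conjugation, under which \<open>I\<close> is stable.\<close>
    have "x \<oplus> y = (i \<oplus> (j \<oplus> i' \<oplus> \<ominus> j)) \<oplus> (j \<oplus> j')"
      using ij ij' c by (simp add: x y add.m_assoc add_cancel_simps)
    moreover have "i \<oplus> (j \<oplus> i' \<oplus> \<ominus> j) \<in> I" "j \<oplus> j' \<in> J"
      using ij ij' c by (simp_all add: ideal_add[OF I] ideal_add_conj[OF I] ideal_add[OF J])
    ultimately show "x \<oplus> y \<in> ?S"
      by blast
  }
  have "\<ominus> x = (\<ominus> j \<oplus> \<ominus> i \<oplus> \<ominus> (\<ominus> j)) \<oplus> \<ominus> j"
    using ij c by (simp add: x add.inv_mult_group add.m_assoc)
  moreover have "\<ominus> j \<oplus> \<ominus> i \<oplus> \<ominus> (\<ominus> j) \<in> I"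
    using ij c ideal_add_conj[OF I, of "\<ominus> j"] ideal_minus[OF I] by simp
  ultimately show "\<ominus> x \<in> ?S"
    using ideal_minus[OF J ij(2)] by blast
  fix a assume a: "a \<in> carrier A"
  have "a \<oplus> x \<oplus> \<ominus> a = (a \<oplus> i \<oplus> \<ominus> a) \<oplus> (a \<oplus> j \<oplus> \<ominus> a)"
    using ij c a by (simp add: x add.m_assoc add_cancel_simps)
  then show "a \<oplus> x \<oplus> \<ominus> a \<in> ?S"
    using ideal_add_conj[OF I a ij(1)] ideal_add_conj[OF J a ij(2)] by blast
  have "brace_lambda A a x = brace_lambda A a i \<oplus> brace_lambda A a j"
    using ij c a by (simp add: x lambda_add)
  then show "brace_lambda A a x \<in> ?S"
    using ideal_lambda[OF I a ij(1)] ideal_lambda[OF J a ij(2)] by blast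
  \<comment> \<open>Circle conjugation does not distribute over \<open>\<oplus>\<close>, so
    \<open>i \<oplus> j\<close> is rewritten as \<open>i \<otimes> k\<close> with \<open>k\<close>
    in \<open>J\<close>. After both factors are conjugated, \<open>circ_eq\<close> turns the product
    back into a sum.\<close>
  define k where "k = brace_lambda A (inv i) j"
  have k: "k \<in> J"
    unfolding k_def using ideal_lambda[OF J] ij c by simp
  have "brace_lambda A i k = j"
    using ij c lambda_circ[of i "inv i" j, symmetric] by (simp add: k_def lambda_one)
  then have "x = i \<otimes> k"
    using ij c k by (simp add: x circ_eq)
  then have "a \<otimes> x \<otimes> inv a = (a \<otimes> i \<otimes> inv a) \<otimes> (a \<otimes> k \<otimes> inv a)"
    using ij c a k by (simp add: circ.m_assoc add_cancel_simps)
  also have "\<dots> = (a \<otimes> i \<otimes> inv a) \<oplus> brace_lambda A (a \<otimes> i \<otimes> inv a) (a \<otimes> k \<otimes> inv a)"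
    using ij c a k by (simp add: circ_eq[of "a \<otimes> i \<otimes> inv a"])
  finally have "a \<otimes> x \<otimes> inv a =
      (a \<otimes> i \<otimes> inv a) \<oplus> brace_lambda A (a \<otimes> i \<otimes> inv a) (a \<otimes> k \<otimes> inv a)" .
  moreover have "brace_lambda A (a \<otimes> i \<otimes> inv a) (a \<otimes> k \<otimes> inv a) \<in> J"
    using ij c a k by (intro ideal_lambda[OF J] ideal_circ_conj[OF J]) simp_all
  ultimately show "a \<otimes> x \<otimes> inv a \<in> ?S"
    using ideal_circ_conj[OF I a ij(1)] by blast
qed

lemma brace_ideal_gen_le: "\<lbrakk>brace_ideal I A; S \<subseteq> I\<rbrakk> \<Longrightarrow> brace_ideal_gen A S \<subseteq> I"
  by (auto simp: brace_ideal_gen_def)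

lemma brace_ideal_gen_superset: "S \<subseteq> brace_ideal_gen A S"
  by (auto simp: brace_ideal_gen_def)

lemma brace_ideal_brace_ideal_gen: "S \<subseteq> carrier A \<Longrightarrow> brace_ideal (brace_ideal_gen A S) A"
  unfolding brace_ideal_gen_def using brace_ideal_carrier by (intro brace_ideal_Inter) auto

text \<open>Zorn's lemma applies because of finite weight: if the union of a chain of proper ideals
  were everything, a finite generating set would already lie in one member of the chain.\<close>

lemma exists_maximal_brace_ideal:
  assumes fw: "brace_finite_weight A" and J: "brace_ideal J A" "J \<noteq> carrier A"
  obtains M where "maximal_brace_ideal M A" "J \<subseteq> M"
proof -
  obtain S where S: "finite S" "brace_ideal_gen A S = carrier A"
    using fw by (auto simp: brace_finite_weight_def)
  have S_sub: "K = carrier A" if "brace_ideal K A" "S \<subseteq> K" for K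
    using brace_ideal_gen_le[OF that] ideal_subset[OF that(1)] S(2) by blast
  let ?P = "{K. brace_ideal K A \<and> K \<noteq> carrier A \<and> J \<subseteq> K}"
  have "\<exists>M\<in>?P. \<forall>X\<in>?P. M \<subseteq> X \<longrightarrow> X = M"
  proof (rule subset_Zorn_nonempty)
    show "?P \<noteq> {}"
      using J by blast
    fix \<C> assume ne: "\<C> \<noteq> {}" and ch: "subset.chain ?P \<C>"
    have P: "brace_ideal K A" "K \<noteq> carrier A" "J \<subseteq> K" if "K \<in> \<C>" for K
      using ch that by (auto simp: subset_chain_def)
    have id: "brace_ideal (\<Union>\<C>) A"
      using ne P(1) ch by (intro brace_ideal_Union_chain) (auto simp: subset_chain_def)
    moreover have "\<Union>\<C> \<noteq> carrier A"
    proof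
      assume "\<Union>\<C> = carrier A"
      then have "S \<subseteq> \<Union>\<C>"
        using S(2) brace_ideal_gen_superset by blast
      then obtain K where "K \<in> \<C>" "S \<subseteq> K"
        using finite_subset_Union_chain[OF S(1) _ ne ch] by blast
      then show False
        using S_sub P by blast
    qed
    ultimately show "\<Union>\<C> \<in> ?P"
      using ne P(3) by blast
  qed
  then obtain M where "M \<in> ?P" "\<forall>X\<in>?P. M \<subseteq> X \<longrightarrow> X = M"
    by blast
  then show ?thesis
    using that[of M] by (auto simp: maximal_brace_ideal_def)
qed

section \<open>Primeness and finiteness of the noncommutative maximal ideals\<close>

lemma maximal_brace_idealD:
  assumes "maximal_brace_ideal M A"
  shows "brace_ideal M A" "M \<noteq> carrier A"
    "\<And>J. \<lbrakk>brace_ideal J A; J \<noteq> carrier A; M \<subseteq> J\<rbrakk> \<Longrightarrow> J = M"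
  using assms by (auto simp: maximal_brace_ideal_def)

text \<open>The sum of \<open>M\<close> and \<open>I\<close> is an ideal strictly larger than
  \<open>M\<close>, hence everything; so every coset of \<open>M\<close> has a representative in
  \<open>I\<close>.\<close>

lemma maximal_brace_ideal_set_add:
  assumes M: "maximal_brace_ideal M A" and I: "brace_ideal I A" "\<not> I \<subseteq> M" and a: "a \<in> carrier A"
  obtains i where "i \<in> I" "M #>\<^bsub>add_monoid A\<^esub> a = M #>\<^bsub>add_monoid A\<^esub> i"
proof -
  note Mi = maximal_brace_idealD(1)[OF M]
  note c = subsetD[OF ideal_subset[OF I(1)]] subsetD[OF ideal_subset[OF Mi]]
  let ?S = "{m \<oplus> i |m i. m \<in> M \<and> i \<in> I}"
  have id: "brace_ideal ?S A"
    using Mi I(1) by (rule brace_ideal_set_add)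
  have "M \<subseteq> ?S"
  proof
    fix m assume "m \<in> M"
    then show "m \<in> ?S"
      using c ideal_zero[OF I(1)] by (intro CollectI exI[of _ m] exI[of _ \<zero>]) simp
  qed
  moreover have "I \<subseteq> ?S"
  proof
    fix i assume "i \<in> I"
    then show "i \<in> ?S"
      using c ideal_zero[OF Mi] by (intro CollectI exI[of _ \<zero>] exI[of _ i]) simp
  qed
  ultimately have "?S \<noteq> M" "M \<subseteq> ?S"
    using I(2) by metis+
  then have "?S = carrier A"
    using maximal_brace_idealD(3)[OF M id] by metis
  then have "a \<in> ?S"
    using a by simp
  then obtain m i where mi: "m \<in> M" "i \<in> I" "a = m \<oplus> i"
    by blast
  then have "M #>\<^bsub>add_monoid A\<^esub> a = M #>\<^bsub>add_monoid A\<^esub> i"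
    using c add.coset_mult_assoc[of M m i] ideal_subset[OF Mi] ideal_rcos_eq_iff[OF Mi, of m] by simp
  with mi(2) show ?thesis
    by (rule that)
qed

lemma maximal_brace_ideal_prime:
  assumes M: "maximal_brace_ideal M A" "\<not> commutative_modulo A M"
    and I: "brace_ideal I A" and J: "brace_ideal J A" and IJ: "I \<inter> J \<subseteq> M"
  shows "I \<subseteq> M \<or> J \<subseteq> M"
proof (rule ccontr)
  assume "\<not> (I \<subseteq> M \<or> J \<subseteq> M)"
  then have nI: "\<not> I \<subseteq> M" and nJ: "\<not> J \<subseteq> M"
    by auto
  note Mi = maximal_brace_idealD(1)[OF M(1)]
  have "brace_star A a b \<in> M \<and> a \<oplus> b \<oplus> \<ominus> a \<oplus> \<ominus> b \<in> M" if ab: "a \<in> carrier A" "b \<in> carrier A" for a b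
  proof -
    \<comment> \<open>Modulo \<open>M\<close>, replace \<open>a\<close> by an element of
      \<open>I\<close> and \<open>b\<close> by an element of \<open>J\<close>. Star products and
      commutators of such elements lie in both ideals.\<close>
    obtain i where i: "i \<in> I" and ai: "M #>\<^bsub>add_monoid A\<^esub> a = M #>\<^bsub>add_monoid A\<^esub> i"
      using maximal_brace_ideal_set_add[OF M(1) I nI ab(1)] .
    obtain j where j: "j \<in> J" and bj: "M #>\<^bsub>add_monoid A\<^esub> b = M #>\<^bsub>add_monoid A\<^esub> j"
      using maximal_brace_ideal_set_add[OF M(1) J nJ ab(2)] .
    have iA: "i \<in> carrier A" and jA: "j \<in> carrier A"
      using i j ideal_subset I J by auto
    have "M #>\<^bsub>add_monoid A\<^esub> brace_star A a b = M #>\<^bsub>add_monoid A\<^esub> brace_star A i j"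
      using quot_star[OF Mi ab] quot_star[OF Mi iA jA] ai bj by simp
    moreover have "brace_star A i j \<in> I \<inter> J"
      using star_mem_left[OF I i jA] star_mem_right[OF J iA j] by blast
    ultimately have 1: "brace_star A a b \<in> M"
      using IJ ideal_rcos_eq_iff[OF Mi star_closed[OF ab]] ideal_rcos_eq_iff[OF Mi star_closed[OF iA jA]]
      by blast
    have q: "M #>\<^bsub>add_monoid A\<^esub> (x \<oplus> y \<oplus> \<ominus> x \<oplus> \<ominus> y) =
        (M #>\<^bsub>add_monoid A\<^esub> x) \<oplus>\<^bsub>brace_quot A M\<^esub> (M #>\<^bsub>add_monoid A\<^esub> y)
        \<oplus>\<^bsub>brace_quot A M\<^esub> \<ominus>\<^bsub>brace_quot A M\<^esub> (M #>\<^bsub>add_monoid A\<^esub> x)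
        \<oplus>\<^bsub>brace_quot A M\<^esub> \<ominus>\<^bsub>brace_quot A M\<^esub> (M #>\<^bsub>add_monoid A\<^esub> y)"
      if "x \<in> carrier A" "y \<in> carrier A" for x y
      using that by (simp add: quot_add[OF Mi] quot_minus[OF Mi])
    have "M #>\<^bsub>add_monoid A\<^esub> (a \<oplus> b \<oplus> \<ominus> a \<oplus> \<ominus> b) = M #>\<^bsub>add_monoid A\<^esub> (i \<oplus> j \<oplus> \<ominus> i \<oplus> \<ominus> j)"
      using q[OF ab] q[OF iA jA] ai bj by simp
    \<comment> \<open>Bracketed one way the commutator is a conjugate of \<open>j\<close> plus
      \<open>\<ominus> j\<close>; bracketed the other way it is \<open>i\<close> plus a conjugate of
      \<open>\<ominus> i\<close>.\<close>
    moreover have "i \<oplus> j \<oplus> \<ominus> i \<oplus> \<ominus> j \<in> J"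
      using ideal_add[OF J ideal_add_conj[OF J iA j] ideal_minus[OF J j]] .
    moreover have "i \<oplus> j \<oplus> \<ominus> i \<oplus> \<ominus> j \<in> I"
      using ideal_add[OF I i ideal_add_conj[OF I jA ideal_minus[OF I i]]] iA jA by (simp add: add.m_assoc)
    ultimately have "a \<oplus> b \<oplus> \<ominus> a \<oplus> \<ominus> b \<in> M"
      using IJ ideal_rcos_eq_iff[OF Mi, of "a \<oplus> b \<oplus> \<ominus> a \<oplus> \<ominus> b"]
        ideal_rcos_eq_iff[OF Mi, of "i \<oplus> j \<oplus> \<ominus> i \<oplus> \<ominus> j"] ab iA jA by auto
    with 1 show ?thesis ..
  qed
  then show False
    using M(2) by (auto simp: commutative_modulo_def)
qed

lemma maximal_brace_ideal_prime_Inter: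
  assumes M: "maximal_brace_ideal M A" "\<not> commutative_modulo A M"
    and F: "finite F" "F \<noteq> {}" "\<And>I. I \<in> F \<Longrightarrow> brace_ideal I A" "\<Inter>F \<subseteq> M"
  shows "\<exists>I\<in>F. I \<subseteq> M"
  using F
proof (induction F rule: finite_ne_induct)
  case (insert I F)
  have "brace_ideal (\<Inter>F) A"
    using insert.hyps(2) insert.prems(1) by (intro brace_ideal_Inter) auto
  then have "I \<subseteq> M \<or> \<Inter>F \<subseteq> M"
    using maximal_brace_ideal_prime[OF M insert.prems(1), of I "\<Inter>F"] insert.prems(2) by auto
  then show ?case
    using insert.IH insert.prems(1) by auto
qed auto

lemma maximal_brace_ideal_subset_eq:
  "\<lbrakk>maximal_brace_ideal M A; maximal_brace_ideal N A; M \<subseteq> N\<rbrakk> \<Longrightarrow> M = N"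
  by (auto simp: maximal_brace_ideal_def)

text \<open>Given infinitely many, the intersections of initial segments of an injective sequence of
  them become stationary. The next member then contains a finite intersection of earlier ones, by
  primeness it contains one of them, and by maximality it equals that one.\<close>

lemma finite_noncommutative_maximal_brace_ideals:
  assumes "brace_Artinian A"
  shows "finite {M. maximal_brace_ideal M A \<and> \<not> commutative_modulo A M}"
proof (rule ccontr)
  assume "infinite {M. maximal_brace_ideal M A \<and> \<not> commutative_modulo A M}"
  then obtain f :: "nat \<Rightarrow> 'a set" where inj: "inj f"
    and f: "range f \<subseteq> {M. maximal_brace_ideal M A \<and> \<not> commutative_modulo A M}"
    using infinite_countable_subset by blast
  have id: "brace_ideal (f n) A" for n
    using f maximal_brace_idealD(1) by blast
  define I where "I n = \<Inter> (f ` {..n})" for n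
  have "brace_ideal (I n) A" for n
    unfolding I_def by (rule brace_ideal_Inter) (auto simp: id)
  moreover have "I (Suc n) \<subseteq> I n" for n
    by (auto simp: I_def)
  ultimately obtain N where "\<forall>n\<ge>N. I n = I N"
    using assms unfolding brace_Artinian_def by blast
  then have "I N = I (Suc N)"
    by (metis le_Suc_eq order_refl)
  then have "\<Inter> (f ` {..N}) \<subseteq> f (Suc N)"
    by (auto simp: I_def)
  then have "\<exists>K\<in>f ` {..N}. K \<subseteq> f (Suc N)"
    using f by (intro maximal_brace_ideal_prime_Inter) (auto simp: id)
  then obtain n where "n \<le> N" "f n \<subseteq> f (Suc N)"
    by auto
  then have "f n = f (Suc N)"
    using f by (intro maximal_brace_ideal_subset_eq) auto
  then show False
    using inj \<open>n \<le> N\<close> by (auto dest: injD)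
qed

text \<open>Prime avoidance by induction on \<open>F\<close>. If the shift found so far falls into
  the new ideal \<open>M\<close>, add an \<open>f\<close> in \<open>E\<close> that lies in all the
  old ideals but not in \<open>M\<close>: membership is unchanged for the old ideals and destroyed
  for \<open>M\<close>.\<close>

lemma exists_shift_avoiding_maximal:
  assumes F: "finite F" "\<And>M. M \<in> F \<Longrightarrow> maximal_brace_ideal M A \<and> \<not> commutative_modulo A M"
    and E: "brace_ideal E A" "commutative_modulo A E" and a: "a \<in> carrier A"
  shows "\<exists>e\<in>E. \<forall>M\<in>F. a \<oplus> e \<notin> M"
  using F
proof (induction F rule: finite_induct)
  case empty
  show ?case
    using ideal_zero[OF E(1)] by blast
next
  case (insert M F)
  obtain e where e: "e \<in> E" "\<forall>N\<in>F. a \<oplus> e \<notin> N"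
    using insert.IH insert.prems by (metis insertI2)
  have M: "maximal_brace_ideal M A" "\<not> commutative_modulo A M"
    using insert.prems[OF insertI1] by simp_all
  note Mi = maximal_brace_idealD(1)[OF M(1)]
  show ?case
  proof (cases "a \<oplus> e \<in> M")
    case False
    with e show ?thesis
      by blast
  next
    case True
    \<comment> \<open>By primeness \<open>M\<close> would contain \<open>E\<close>, making it
      commutative, or a member of \<open>F\<close>, which would equal \<open>M\<close> by
      maximality.\<close>
    have "\<not> \<Inter> (insert E F) \<subseteq> M"
    proof
      assume "\<Inter> (insert E F) \<subseteq> M"
      then have "\<exists>I\<in>insert E F. I \<subseteq> M"
        using insert.hyps(1) insert.prems E(1)
        by (intro maximal_brace_ideal_prime_Inter[OF M]) (auto dest: maximal_brace_idealD(1))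
      moreover have "\<not> E \<subseteq> M"
        using E(2) M(2) by (auto simp: commutative_modulo_def)
      ultimately show False
        using insert.hyps(2) insert.prems maximal_brace_ideal_subset_eq[OF _ M(1)] by blast
    qed
    then obtain f where f: "f \<in> E" "\<And>N. N \<in> F \<Longrightarrow> f \<in> N" "f \<notin> M"
      by auto
    have eA: "e \<in> carrier A" "f \<in> carrier A"
      using e(1) f(1) ideal_subset[OF E(1)] by auto
    have "a \<oplus> (e \<oplus> f) \<notin> M"
    proof
      assume "a \<oplus> (e \<oplus> f) \<in> M"
      then have "\<ominus> (a \<oplus> e) \<oplus> ((a \<oplus> e) \<oplus> f) \<in> M"
        using ideal_add[OF Mi ideal_minus[OF Mi True]] a eA by (simp add: add.m_assoc)
      then show False
        using f(3) a eA by (simp add: add_cancel_simps)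
    qed
    moreover have "a \<oplus> (e \<oplus> f) \<notin> N" if "N \<in> F" for N
    proof
      note Ni = maximal_brace_idealD(1)[OF conjunct1[OF insert.prems[OF insertI2[OF that]]]]
      assume "a \<oplus> (e \<oplus> f) \<in> N"
      then have "(a \<oplus> (e \<oplus> f)) \<oplus> \<ominus> f \<in> N"
        using ideal_add[OF Ni _ ideal_minus[OF Ni f(2)[OF that]]] by blast
      then show False
        using e(2) that a eA by (simp add: add.m_assoc)
    qed
    ultimately show ?thesis
      using ideal_add[OF E(1) e(1) f(1)] by blast
  qed
qed

text \<open>Nonemptiness of \<open>S\<close> is due to the convention for the zero brace, which has
  weight 1 although the empty set generates it.\<close>

lemma brace_weight_le:
  assumes "finite S" "S \<noteq> {}" "S \<subseteq> carrier A" "brace_ideal_gen A S = carrier A"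
  shows "brace_weight A \<le> enat (card S)"
proof (cases "carrier A = {\<zero>}")
  case True
  moreover have "1 \<le> card S"
    using assms(1,2) by (simp add: Suc_le_eq card_gt_0_iff)
  ultimately show ?thesis
    by (simp add: brace_weight_def one_enat_def)
next
  case False
  then show ?thesis
    using assms by (auto simp: brace_weight_def intro!: Inf_lower)
qed

text \<open>For the zero brace the witness is the singleton of zero, matching the convention.
  Otherwise the infimum is attained because \<open>enat\<close> is well-ordered.\<close>

lemma brace_weight_attained:
  assumes "brace_finite_weight A"
  obtains S where "finite S" "S \<noteq> {}" "S \<subseteq> carrier A" "brace_ideal_gen A S = carrier A"
    "brace_weight A = enat (card S)"
proof (cases "carrier A = {\<zero>}")
  case True
  have "brace_ideal_gen A {\<zero>} = carrier A"
    using True ideal_subset[OF brace_ideal_brace_ideal_gen[of "{\<zero>}"]]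
      brace_ideal_gen_superset[of "{\<zero>}"] by auto
  then show ?thesis
    using that[of "{\<zero>}"] True by (simp add: brace_weight_def one_enat_def)
next
  case False
  let ?W = "{enat (card S) |S. finite S \<and> S \<subseteq> carrier A \<and> brace_ideal_gen A S = carrier A}"
  obtain S0 where "finite S0" "S0 \<subseteq> carrier A" "brace_ideal_gen A S0 = carrier A"
    using assms unfolding brace_finite_weight_def by blast
  then have "enat (card S0) \<in> ?W"
    by blast
  then have "Inf ?W \<in> ?W"
    by (rule wellorder_InfI)
  then obtain S where S: "finite S" "S \<subseteq> carrier A" "brace_ideal_gen A S = carrier A"
    and "Inf ?W = enat (card S)"
    by (elim CollectE exE conjE)
  then have weight: "brace_weight A = enat (card S)"
    using False by (simp add: brace_weight_def)
  have circ_zero: "a \<otimes> \<zero> = a" if "a \<in> carrier A" for a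
    using circ.r_one[OF that] by (simp add: one_eq_zero)
  \<comment> \<open>The empty set generates at most the zero ideal, so it cannot generate a nonzero
    brace.\<close>
  have "brace_ideal {\<zero>} A"
    by (rule brace_idealI) (auto simp: brace_lambda_def circ_zero one_eq_zero)
  then have "S \<noteq> {}"
    using S(3) False brace_ideal_gen_le[of "{\<zero>}" "{}"] add.one_closed by auto
  with S weight show ?thesis
    by (intro that)
qed

end

section \<open>Homomorphisms onto abelian groups\<close>

text \<open>This is a surjective brace homomorphism onto the abelian group \<open>G\<close> viewed
  as a trivial brace; multiplicativity is derived in \<open>phi_circ\<close>. Working with an
  abstract target keeps the iterated cosets of \<open>brace_top_ab\<close> out of the weight
  argument.\<close>

locale brace_epi_comm_group = skew_left_brace A + G: comm_group G
  for A :: "('a, 'm) ring_scheme" (structure) and G :: "('c, 'n) monoid_scheme" +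
  fixes \<phi> :: "'a \<Rightarrow> 'c"
  assumes phi_add: "\<lbrakk>a \<in> carrier A; b \<in> carrier A\<rbrakk> \<Longrightarrow> \<phi> (a \<oplus> b) = \<phi> a \<otimes>\<^bsub>G\<^esub> \<phi> b"
    and phi_surj: "\<phi> ` carrier A = carrier G"
    and phi_star: "\<lbrakk>a \<in> carrier A; b \<in> carrier A\<rbrakk> \<Longrightarrow> \<phi> (brace_star A a b) = \<one>\<^bsub>G\<^esub>"
begin

interpretation add: group "add_monoid A"
  rewrites "carrier (add_monoid A) = carrier A"
    and "monoid.mult (add_monoid A) = add A"
    and "one (add_monoid A) = zero A"
    and "m_inv (add_monoid A) = a_inv A"
  by (rule add_group) (simp_all add: a_inv_def)

interpretation circ: group A
  by (rule circ_group)

lemma phi_group_hom: "group_hom (add_monoid A) G \<phi>"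
proof -
  have "\<phi> \<in> hom (add_monoid A) G"
    using phi_surj by (auto simp: hom_def phi_add)
  then show ?thesis
    by (simp add: group_hom_def group_hom_axioms_def add_group G.is_group)
qed

interpretation phi: group_hom "add_monoid A" G \<phi>
  rewrites "carrier (add_monoid A) = carrier A"
    and "monoid.mult (add_monoid A) = add A"
    and "one (add_monoid A) = zero A"
    and "m_inv (add_monoid A) = a_inv A"
  using phi_group_hom by (simp_all add: a_inv_def)

interpretation T: skew_left_brace "trivial_brace G"
  using G.is_group by (rule skew_left_brace_trivial_brace)

lemma phi_circ: "\<lbrakk>a \<in> carrier A; b \<in> carrier A\<rbrakk> \<Longrightarrow> \<phi> (a \<otimes> b) = \<phi> a \<otimes>\<^bsub>G\<^esub> \<phi> b"
  by (simp add: circ_eq_star star_closed phi_star)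

lemma phi_circ_inv:
  assumes "a \<in> carrier A"
  shows "\<phi> (inv a) = inv\<^bsub>G\<^esub> \<phi> a"
proof -
  have "\<phi> (inv a) \<otimes>\<^bsub>G\<^esub> \<phi> a = \<one>\<^bsub>G\<^esub>"
    using assms one_eq_zero by (simp flip: phi_circ)
  then show ?thesis
    using assms G.inv_equality by simp
qed

lemma phi_lambda: "\<lbrakk>a \<in> carrier A; b \<in> carrier A\<rbrakk> \<Longrightarrow> \<phi> (brace_lambda A a b) = \<phi> b"
  by (simp add: brace_lambda_def phi_circ G.m_assoc[symmetric])

text \<open>After applying \<open>\<phi>\<close>, conjugations of both kinds and all maps
  \<open>brace_lambda A a\<close> act as the identity, so only the subgroup conditions
  remain.\<close>

lemma brace_ideal_vimage:
  assumes H: "subgroup H G"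
  shows "brace_ideal {x \<in> carrier A. \<phi> x \<in> H} A"
proof -
  have conj: "x \<otimes>\<^bsub>G\<^esub> y \<otimes>\<^bsub>G\<^esub> inv\<^bsub>G\<^esub> x = y" if "x \<in> carrier G" "y \<in> carrier G" for x y
    using that G.m_comm[of x y] by (simp add: G.m_assoc)
  show ?thesis
    by (rule brace_idealI)
      (auto simp: phi_circ phi_circ_inv phi_lambda lambda_closed conj
        subgroup.one_closed[OF H] subgroup.m_closed[OF H] subgroup.m_inv_closed[OF H])
qed

text \<open>With \<open>trivial_brace_ideal_of_subgroup\<close>, this identifies the ideals of the
  trivial brace on \<open>G\<close> with the subgroups of \<open>G\<close>.\<close>

lemma subgroup_of_trivial_brace_ideal:
  assumes "brace_ideal N (trivial_brace G)"
  shows "subgroup N G"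
proof -
  have "subgroup N (trivial_brace G)"
    using assms by (simp add: brace_ideal_def normal_imp_subgroup)
  then have *: "N \<subseteq> carrier G" "\<one>\<^bsub>G\<^esub> \<in> N" "\<And>x y. \<lbrakk>x \<in> N; y \<in> N\<rbrakk> \<Longrightarrow> x \<otimes>\<^bsub>G\<^esub> y \<in> N"
    "\<And>x. x \<in> N \<Longrightarrow> inv\<^bsub>trivial_brace G\<^esub> x \<in> N"
    by (auto simp: subgroup_def trivial_brace_def)
  have "inv\<^bsub>trivial_brace G\<^esub> x = inv\<^bsub>G\<^esub> x" for x
    by (simp add: m_inv_def trivial_brace_def)
  with * show ?thesis
    by (auto simp: subgroup_def)
qed

lemma trivial_brace_ideal_of_subgroup:
  assumes H: "subgroup H G"
  shows "brace_ideal H (trivial_brace G)"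
proof -
  have sub: "x \<in> carrier G" if "x \<in> H" for x
    using that subgroup.subset[OF H] by blast
  have minv: "inv\<^bsub>trivial_brace G\<^esub> x = inv\<^bsub>G\<^esub> x" "\<ominus>\<^bsub>trivial_brace G\<^esub> x = inv\<^bsub>G\<^esub> x" for x
    by (simp_all add: a_inv_def m_inv_def trivial_brace_def)
  have sel: "carrier (trivial_brace G) = carrier G" "\<zero>\<^bsub>trivial_brace G\<^esub> = \<one>\<^bsub>G\<^esub>"
    "monoid.mult (trivial_brace G) = monoid.mult G" "add (trivial_brace G) = monoid.mult G"
    by (simp_all add: trivial_brace_def)
  have conj: "x \<otimes>\<^bsub>G\<^esub> y \<otimes>\<^bsub>G\<^esub> inv\<^bsub>G\<^esub> x = y" if "x \<in> carrier G" "y \<in> carrier G" for x y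
    using that G.m_comm[of x y] by (simp add: G.m_assoc)
  show ?thesis
    by (rule T.brace_idealI)
      (auto simp: sel minv sub conj brace_lambda_def G.m_assoc[symmetric]
        subgroup.one_closed[OF H] subgroup.m_closed[OF H] subgroup.m_inv_closed[OF H])
qed

lemma carrier_trivial_brace: "carrier (trivial_brace G) = carrier G"
  by (simp add: trivial_brace_def)

text \<open>The preimage of the ideal generated by the image of \<open>S\<close> is an ideal
  containing \<open>S\<close>, hence all of \<open>A\<close>; surjectivity finishes the
  argument.\<close>

lemma brace_ideal_gen_image:
  assumes S: "S \<subseteq> carrier A" "brace_ideal_gen A S = carrier A"
  shows "brace_ideal_gen (trivial_brace G) (\<phi> ` S) = carrier (trivial_brace G)"
proof
  have sub: "\<phi> ` S \<subseteq> carrier (trivial_brace G)"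
    using S(1) by (auto simp: carrier_trivial_brace)
  let ?J = "brace_ideal_gen (trivial_brace G) (\<phi> ` S)"
  note J = T.brace_ideal_brace_ideal_gen[OF sub]
  show "?J \<subseteq> carrier (trivial_brace G)"
    by (rule T.ideal_subset[OF J])
  have "S \<subseteq> {x \<in> carrier A. \<phi> x \<in> ?J}"
    using S(1) T.brace_ideal_gen_superset[of "\<phi> ` S"] by blast
  then have "carrier A \<subseteq> {x \<in> carrier A. \<phi> x \<in> ?J}"
    using brace_ideal_gen_le[OF brace_ideal_vimage[OF subgroup_of_trivial_brace_ideal[OF J]], of S] S(2)
    by simp
  then have "\<phi> ` carrier A \<subseteq> ?J"
    by auto
  then show "carrier (trivial_brace G) \<subseteq> ?J"
    by (simp add: phi_surj carrier_trivial_brace)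
qed

lemma brace_finite_weight_image:
  assumes "brace_finite_weight A"
  shows "brace_finite_weight (trivial_brace G)"
proof -
  obtain S where S: "finite S" "S \<subseteq> carrier A" "brace_ideal_gen A S = carrier A"
    using assms unfolding brace_finite_weight_def by blast
  then have "\<phi> ` S \<subseteq> carrier (trivial_brace G)"
    by (auto simp: carrier_trivial_brace)
  then show ?thesis
    using brace_ideal_gen_image[OF S(2,3)] S(1) unfolding brace_finite_weight_def by blast
qed

lemma brace_weight_image_le:
  assumes "brace_finite_weight A"
  shows "brace_weight (trivial_brace G) \<le> brace_weight A"
proof -
  obtain S where S: "finite S" "S \<noteq> {}" "S \<subseteq> carrier A" "brace_ideal_gen A S = carrier A"
    and w: "brace_weight A = enat (card S)"
    using brace_weight_attained[OF assms] .
  have "brace_weight (trivial_brace G) \<le> enat (card (\<phi> ` S))"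
    using S by (intro T.brace_weight_le brace_ideal_gen_image) (auto simp: carrier_trivial_brace)
  also have "\<dots> \<le> enat (card S)"
    using card_image_le[OF S(1)] by simp
  finally show ?thesis
    using w by simp
qed

lemma lift_generators:
  assumes art: "brace_Artinian A" and fw: "brace_finite_weight A"
    and ker: "\<And>M. \<lbrakk>maximal_brace_ideal M A; commutative_modulo A M\<rbrakk>
      \<Longrightarrow> {x \<in> carrier A. \<phi> x = \<one>\<^bsub>G\<^esub>} \<subseteq> M"
    and T: "finite T" "T \<noteq> {}" "T \<subseteq> carrier G"
      "brace_ideal_gen (trivial_brace G) T = carrier (trivial_brace G)"
  obtains S where "finite S" "S \<noteq> {}" "S \<subseteq> carrier A" "brace_ideal_gen A S = carrier A"
    "card S \<le> card T"
proof -
  define E where "E = {x \<in> carrier A. \<phi> x = \<one>\<^bsub>G\<^esub>}"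
  have E: "brace_ideal E A"
    using brace_ideal_vimage[OF G.triv_subgroup] by (simp add: E_def)
  have comm: "x \<otimes>\<^bsub>G\<^esub> y \<otimes>\<^bsub>G\<^esub> inv\<^bsub>G\<^esub> x \<otimes>\<^bsub>G\<^esub> inv\<^bsub>G\<^esub> y = \<one>\<^bsub>G\<^esub>"
    if "x \<in> carrier G" "y \<in> carrier G" for x y
    using that G.m_comm[of x y] by (simp add: G.m_assoc)
  have E_comm: "commutative_modulo A E"
    by (simp add: commutative_modulo_def E_def star_closed phi_star comm)
  obtain t0 where t0: "t0 \<in> T"
    using T(2) by blast
  define g where "g = inv_into (carrier A) \<phi>"
  have g: "g t \<in> carrier A" "\<phi> (g t) = t" if "t \<in> T" for t
    using that T(3) unfolding g_def phi_surj[symmetric] by (auto intro: inv_into_into f_inv_into_f)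
  let ?F = "{M. maximal_brace_ideal M A \<and> \<not> commutative_modulo A M}"
  obtain e where e: "e \<in> E" and avoid: "\<And>M. M \<in> ?F \<Longrightarrow> g t0 \<oplus> e \<notin> M"
    using exists_shift_avoiding_maximal[OF finite_noncommutative_maximal_brace_ideals[OF art] _ E E_comm
        g(1)[OF t0]] by auto
  have eA: "e \<in> carrier A" "\<phi> e = \<one>\<^bsub>G\<^esub>"
    using e by (auto simp: E_def)
  \<comment> \<open>Only the lift of \<open>t0\<close> is moved. As \<open>e\<close> lies in the
    kernel, \<open>s\<close> is still a section of \<open>\<phi>\<close> on
    \<open>T\<close>.\<close>
  define s where "s t = (if t = t0 then g t0 \<oplus> e else g t)" for t
  have s: "s t \<in> carrier A" "\<phi> (s t) = t" if "t \<in> T" for t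
    using that g[OF that] g[OF t0] eA G.r_one T(3) t0 by (auto simp: s_def)
  have sub: "s ` T \<subseteq> carrier A"
    using s(1) by blast
  let ?J = "brace_ideal_gen A (s ` T)"
  have "?J = carrier A"
  proof (rule ccontr)
    assume "?J \<noteq> carrier A"
    then obtain M where M: "maximal_brace_ideal M A" and JM: "?J \<subseteq> M"
      using exists_maximal_brace_ideal[OF fw brace_ideal_brace_ideal_gen[OF sub]] by blast
    note Mi = maximal_brace_idealD(1)[OF M]
    have sM: "s t \<in> M" if "t \<in> T" for t
      using that JM brace_ideal_gen_superset[of "s ` T"] by blast
    have "s t0 = g t0 \<oplus> e"
      by (simp add: s_def)
    \<comment> \<open>The element \<open>s t0\<close> lies in \<open>M\<close> but avoids every
      noncommutative maximal ideal.\<close>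
    then have "commutative_modulo A M"
      using avoid[of M] M sM[OF t0] by auto
    then have EM: "E \<subseteq> M"
      unfolding E_def by (rule ker[OF M])
    \<comment> \<open>The image of \<open>M\<close> is an ideal of the trivial brace that contains
      the generating set \<open>T\<close>, so it is all of \<open>G\<close>.\<close>
    have H: "subgroup (\<phi> ` M) G"
      using phi.subgroup_img_is_subgroup[OF ideal_add_subgroup[OF Mi]] .
    have "T \<subseteq> \<phi> ` M"
    proof
      fix t assume "t \<in> T"
      then show "t \<in> \<phi> ` M"
        using s(2) sM by (metis imageI)
    qed
    then have "carrier G \<subseteq> \<phi> ` M"
      using T.brace_ideal_gen_le[OF trivial_brace_ideal_of_subgroup[OF H], of T] T(4)
      by (simp add: carrier_trivial_brace)
    \<comment> \<open>Each \<open>x\<close> has the same image as some \<open>m\<close> in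
      \<open>M\<close>, and their difference lies in the kernel, which is inside
      \<open>M\<close>.\<close>
    have "carrier A \<subseteq> M"
    proof
      fix x assume x: "x \<in> carrier A"
      then obtain m where m: "m \<in> M" "\<phi> x = \<phi> m"
        using \<open>carrier G \<subseteq> \<phi> ` M\<close> phi.hom_closed by blast
      have mA: "m \<in> carrier A"
        using m(1) ideal_subset[OF Mi] by blast
      have "x \<oplus> \<ominus> m \<in> M"
        using x mA m(2) EM by (auto simp: E_def)
      then have "(x \<oplus> \<ominus> m) \<oplus> m \<in> M"
        using ideal_add[OF Mi] m(1) by blast
      then show "x \<in> M"
        using x mA by (simp add: add.m_assoc)
    qed
    then show False
      using maximal_brace_idealD(2)[OF M] ideal_subset[OF Mi] by blast
  qed
  then show ?thesis
    using T(1,2) sub card_image_le[OF T(1), of s] by (intro that[of "s ` T"]) simp_all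
qed

lemma brace_weight_eq:
  assumes "brace_Artinian A" "brace_finite_weight A"
    and "\<And>M. \<lbrakk>maximal_brace_ideal M A; commutative_modulo A M\<rbrakk>
      \<Longrightarrow> {x \<in> carrier A. \<phi> x = \<one>\<^bsub>G\<^esub>} \<subseteq> M"
  shows "brace_weight A = brace_weight (trivial_brace G)"
proof (rule antisym)
  obtain T where T: "finite T" "T \<noteq> {}" "T \<subseteq> carrier G"
      "brace_ideal_gen (trivial_brace G) T = carrier (trivial_brace G)"
    and w: "brace_weight (trivial_brace G) = enat (card T)"
    using T.brace_weight_attained[OF brace_finite_weight_image[OF assms(2)]]
    unfolding carrier_trivial_brace .
  obtain S where S: "finite S" "S \<noteq> {}" "S \<subseteq> carrier A" "brace_ideal_gen A S = carrier A"
    and card: "card S \<le> card T"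
    using lift_generators[OF assms T] .
  have "brace_weight A \<le> enat (card S)"
    using S by (rule brace_weight_le)
  then show "brace_weight A \<le> brace_weight (trivial_brace G)"
    using card w by (metis enat_ord_simps(1) order_trans)
qed (rule brace_weight_image_le[OF assms(2)])

lemma brace_weight_cyclic:
  assumes "cyclic_group G" "brace_finite_weight A"
  shows "brace_weight (trivial_brace G) = 1"
proof (rule antisym)
  obtain x where x: "x \<in> carrier G" "subgroup_generated G {x} = G"
    using assms(1) by (auto simp: cyclic_group_def)
  have "carrier (subgroup_generated G {x}) = generate G {x}"
    using x(1) by (simp add: carrier_subgroup_generated)
  then have gen: "generate G {x} = carrier G"
    using x(2) by simp
  have sub: "{x} \<subseteq> carrier (trivial_brace G)"
    using x(1) by (simp add: carrier_trivial_brace)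
  let ?J = "brace_ideal_gen (trivial_brace G) {x}"
  note J = T.brace_ideal_brace_ideal_gen[OF sub]
  have "generate G {x} \<subseteq> ?J"
    using T.brace_ideal_gen_superset
    by (rule G.generate_subgroup_incl[OF _ subgroup_of_trivial_brace_ideal[OF J]])
  then have "?J = carrier (trivial_brace G)"
    using T.ideal_subset[OF J] gen by (simp add: carrier_trivial_brace)
  then have "brace_weight (trivial_brace G) \<le> enat (card {x})"
    using sub by (intro T.brace_weight_le) simp_all
  then show "brace_weight (trivial_brace G) \<le> 1"
    by (simp add: one_enat_def)
  \<comment> \<open>The lower bound comes from a generating set of minimal size that is nonempty;
    this also covers trivial \<open>G\<close>.\<close>
  obtain S where "finite S" "S \<noteq> {}" "S \<subseteq> carrier (trivial_brace G)"
    "brace_ideal_gen (trivial_brace G) S = carrier (trivial_brace G)"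
    "brace_weight (trivial_brace G) = enat (card S)"
    by (rule T.brace_weight_attained[OF brace_finite_weight_image[OF assms(2)]])
  then show "1 \<le> brace_weight (trivial_brace G)"
    by (simp add: one_enat_def Suc_le_eq card_gt_0_iff)
qed

text \<open>By the first isomorphism theorem and Lagrange, the order of \<open>G\<close> divides
  that of \<open>A\<close>, and divisors of square-free numbers are square-free.\<close>

lemma cyclic_group_if_squarefree:
  assumes "finite (carrier A)" "squarefree (card (carrier A))"
  shows "cyclic_group G"
proof -
  have fin: "finite (carrier G)"
    using assms(1) phi_surj by (metis finite_imageI)
  let ?K = "kernel (add_monoid A) G \<phi>"
  have "(\<lambda>X. the_elem (\<phi> ` X)) \<in> iso (add_monoid A Mod ?K) G"
    using group_hom.FactGroup_iso_set[OF phi_group_hom] phi_surj by simp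
  then have "card (rcosets\<^bsub>add_monoid A\<^esub> ?K) = order G"
    by (auto simp: iso_def FactGroup_def order_def dest: bij_betw_same_card)
  then have "order G dvd card (carrier A)"
    using group.lagrange[OF add_group group_hom.subgroup_kernel[OF phi_group_hom]]
    by (metis dvd_triv_left order_def partial_object.select_convs(1))
  then have "squarefree (order G)"
    using assms(2) squarefree_mono by blast
  then show ?thesis
    by (rule G.cyclic_group_if_squarefree_order[OF fin])
qed

end

section \<open>The abelian quotient of a skew left brace\<close>

text \<open>The composite of two projections, first modulo the square and then modulo the derived
  subgroup, so its values are cosets of cosets.\<close>

definition top_ab_map :: "('a, 'm) ring_scheme \<Rightarrow> 'a \<Rightarrow> 'a set set" where
  "top_ab_map A x =
     (let C = add_monoid A Mod brace_square A
      in derived C (carrier C) #>\<^bsub>C\<^esub> (brace_square A #>\<^bsub>add_monoid A\<^esub> x))"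

context skew_left_brace
begin

interpretation add: group "add_monoid A"
  rewrites "carrier (add_monoid A) = carrier A"
    and "monoid.mult (add_monoid A) = add A"
    and "one (add_monoid A) = zero A"
    and "m_inv (add_monoid A) = a_inv A"
  by (rule add_group) (simp_all add: a_inv_def)

text \<open>Additivity of \<open>brace_lambda A a\<close> makes an additive conjugate of a star
  product a combination of two star products with the same \<open>a\<close>; this gives normality of
  \<open>brace_square A\<close>.\<close>

lemma star_conj:
  assumes "a \<in> carrier A" "b \<in> carrier A" "c \<in> carrier A"
  shows "b \<oplus> brace_star A a c \<oplus> \<ominus> b = \<ominus> brace_star A a b \<oplus> brace_star A a (b \<oplus> c)"
  using assms
  by (simp add: brace_star_def a_minus_def lambda_add lambda_closed add.inv_mult_group
      add.m_assoc add_cancel_simps)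

lemma brace_square_normal: "brace_square A \<lhd> add_monoid A"
  unfolding brace_square_def
proof (rule group.normal_generate_if_conj_mem[OF add_group])
  let ?S = "{brace_star A a b |a b. a \<in> carrier A \<and> b \<in> carrier A}"
  show sub: "?S \<subseteq> carrier (add_monoid A)"
    by (auto simp: star_closed)
  fix h g assume "h \<in> ?S" and "g \<in> carrier (add_monoid A)"
  then obtain a c where h: "h = brace_star A a c" and car: "a \<in> carrier A" "c \<in> carrier A" "g \<in> carrier A"
    by auto
  have "brace_star A a g \<in> ?S" "brace_star A a (g \<oplus> c) \<in> ?S"
    using car by auto
  then have "inv\<^bsub>add_monoid A\<^esub> brace_star A a g \<otimes>\<^bsub>add_monoid A\<^esub> brace_star A a (g \<oplus> c)
      \<in> generate (add_monoid A) ?S"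
    by (intro generate.eng generate.inv generate.incl)
  then show "g \<otimes>\<^bsub>add_monoid A\<^esub> h \<otimes>\<^bsub>add_monoid A\<^esub> inv\<^bsub>add_monoid A\<^esub> g
      \<in> generate (add_monoid A) ?S"
    using star_conj[OF car(1,3,2)] by (simp add: h a_inv_def)
qed

lemma brace_top_ab_eq:
  "brace_top_ab A = abelianization (add_monoid A Mod brace_square A)"
  by (simp add: brace_top_ab_def brace_quot_def FactGroup_def)

lemma top_ab_map_epi: "brace_epi_comm_group A (brace_top_ab A) (top_ab_map A)"
proof -
  let ?S = "brace_square A"
  let ?C = "add_monoid A Mod ?S"
  let ?D = "derived ?C (carrier ?C)"
  interpret S: normal ?S "add_monoid A"
    by (rule brace_square_normal)
  interpret C: group ?C
    by (rule S.factorgroup_is_group)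
  interpret D: normal ?D ?C
    by (rule C.derived_is_normal) (rule C.normal_self)
  have top: "brace_top_ab A = ?C Mod ?D"
    by (simp add: brace_top_ab_eq abelianization_def)
  interpret Q: comm_group "?C Mod ?D"
    by (rule C.derived_quot_is_comm_group)
  note hs = hom_mult[OF S.r_coset_hom_Mod] and hD = hom_mult[OF D.r_coset_hom_Mod]
  have cl: "?S #>\<^bsub>add_monoid A\<^esub> x \<in> carrier ?C" if "x \<in> carrier A" for x
    using that hom_in_carrier[OF S.r_coset_hom_Mod] by simp
  have map: "top_ab_map A x = ?D #>\<^bsub>?C\<^esub> (?S #>\<^bsub>add_monoid A\<^esub> x)" for x
    by (simp add: top_ab_map_def Let_def)
  show ?thesis
    unfolding top
  proof unfold_locales
    fix a b assume ab: "a \<in> carrier A" "b \<in> carrier A"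
    then show "top_ab_map A (a \<oplus> b) = top_ab_map A a \<otimes>\<^bsub>?C Mod ?D\<^esub> top_ab_map A b"
      unfolding map using hs[of a b] hD[OF cl cl] by simp
    have "brace_star A a b \<in> ?S"
      unfolding brace_square_def using ab by (auto intro: generate.incl)
    then have "?S #>\<^bsub>add_monoid A\<^esub> brace_star A a b = ?S"
      using S.rcos_const[OF add_group] by simp
    moreover have "?D #>\<^bsub>?C\<^esub> ?S = ?D"
      using D.rcos_const[OF C.is_group D.one_closed] by simp
    ultimately show "top_ab_map A (brace_star A a b) = \<one>\<^bsub>?C Mod ?D\<^esub>"
      unfolding map by simp
  next
    show "top_ab_map A ` carrier A = carrier (?C Mod ?D)"
      unfolding map carrier_FactGroup by auto
  qed
qed

text \<open>The subgroup \<open>M\<close> contains the square, and its image modulo the square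
  contains the derived subgroup. A kernel element has its coset in that image, so it lies in
  \<open>M\<close>. Taking \<open>M\<close> to be just a subgroup allows images of ideals under a
  projection to be used directly.\<close>

lemma mem_if_top_ab_map_one:
  assumes M: "subgroup M (add_monoid A)" "commutative_modulo A M"
    and x: "x \<in> carrier A" "top_ab_map A x = \<one>\<^bsub>brace_top_ab A\<^esub>"
  shows "x \<in> M"
proof -
  let ?S = "brace_square A"
  let ?C = "add_monoid A Mod ?S"
  let ?D = "derived ?C (carrier ?C)"
  interpret S: normal ?S "add_monoid A"
    by (rule brace_square_normal)
  interpret C: group ?C
    by (rule S.factorgroup_is_group)
  have D: "subgroup ?D ?C"
    by (rule C.derived_is_subgroup) simp
  have "?S \<subseteq> M"
    unfolding brace_square_def using M(2)
    by (intro group.generate_subgroup_incl[OF add_group _ M(1)]) (auto simp: commutative_modulo_def)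
  have cl: "?S #>\<^bsub>add_monoid A\<^esub> x \<in> carrier ?C"
    using x(1) by (auto simp: carrier_FactGroup)
  have "?D #>\<^bsub>?C\<^esub> (?S #>\<^bsub>add_monoid A\<^esub> x) = ?D"
    using x(2) by (simp add: top_ab_map_def Let_def brace_top_ab_eq abelianization_def)
  then have "?S #>\<^bsub>add_monoid A\<^esub> x \<in> ?D"
    using C.coset_join1[OF _ cl D] by simp
  also have "?D \<subseteq> (\<lambda>m. ?S #>\<^bsub>add_monoid A\<^esub> m) ` M"
    using M by (intro S.derived_FactGroup_subset) (auto simp: commutative_modulo_def a_inv_def)
  finally show ?thesis
    using S.mem_if_rcos_mem_image[OF M(1) \<open>?S \<subseteq> M\<close>] x(1) by simp
qed

section \<open>Passage to the quotient by the radical\<close>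

lemma brace_ideal_Rad: "brace_ideal (brace_Rad A) A"
proof (cases "\<exists>M. maximal_brace_ideal M A")
  case True
  then have "brace_ideal (\<Inter> {M. maximal_brace_ideal M A}) A"
    by (intro brace_ideal_Inter) (auto dest: maximal_brace_idealD(1))
  with True show ?thesis
    by (simp add: brace_Rad_def)
qed (simp add: brace_Rad_def brace_ideal_carrier)

lemma brace_Rad_subset: "maximal_brace_ideal M A \<Longrightarrow> brace_Rad A \<subseteq> M"
  by (auto simp: brace_Rad_def)

text \<open>Precomposing with the projection gives an epimorphism defined on \<open>A\<close>
  itself, so the Artinian property and finite weight are used for \<open>A\<close> and never have to
  be transferred to the quotient.\<close>

lemma top_ab_map_quot_epi:
  assumes I: "brace_ideal I A"
  shows "brace_epi_comm_group A (brace_top_ab (brace_quot A I))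
    (\<lambda>x. top_ab_map (brace_quot A I) (I #>\<^bsub>add_monoid A\<^esub> x))"
proof -
  interpret Q: brace_epi_comm_group "brace_quot A I" "brace_top_ab (brace_quot A I)"
    "top_ab_map (brace_quot A I)"
    by (rule skew_left_brace.top_ab_map_epi[OF skew_left_brace_quot[OF I]])
  have cl: "I #>\<^bsub>add_monoid A\<^esub> x \<in> carrier (brace_quot A I)" if "x \<in> carrier A" for x
    using that by (simp add: carrier_quot[OF I])
  show ?thesis
  proof unfold_locales
    fix a b assume ab: "a \<in> carrier A" "b \<in> carrier A"
    show "top_ab_map (brace_quot A I) (I #>\<^bsub>add_monoid A\<^esub> (a \<oplus> b)) =
        top_ab_map (brace_quot A I) (I #>\<^bsub>add_monoid A\<^esub> a)
        \<otimes>\<^bsub>brace_top_ab (brace_quot A I)\<^esub> top_ab_map (brace_quot A I) (I #>\<^bsub>add_monoid A\<^esub> b)"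
      using Q.phi_add[OF cl[OF ab(1)] cl[OF ab(2)]] quot_add[OF I ab] by simp
    show "top_ab_map (brace_quot A I) (I #>\<^bsub>add_monoid A\<^esub> brace_star A a b) =
        \<one>\<^bsub>brace_top_ab (brace_quot A I)\<^esub>"
      using Q.phi_star[OF cl[OF ab(1)] cl[OF ab(2)]] quot_star[OF I ab] by simp
  next
    show "(\<lambda>x. top_ab_map (brace_quot A I) (I #>\<^bsub>add_monoid A\<^esub> x)) ` carrier A =
        carrier (brace_top_ab (brace_quot A I))"
      using Q.phi_surj by (simp add: carrier_quot[OF I] image_image)
  qed
qed

text \<open>Apply \<open>mem_if_top_ab_map_one\<close> in the quotient to the image of
  \<open>M\<close>, and return to \<open>A\<close> using that \<open>M\<close> contains
  \<open>I\<close>.\<close>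

lemma mem_if_top_ab_map_quot_one:
  assumes I: "brace_ideal I A" and M: "brace_ideal M A" "I \<subseteq> M" "commutative_modulo A M"
    and x: "x \<in> carrier A"
      "top_ab_map (brace_quot A I) (I #>\<^bsub>add_monoid A\<^esub> x) = \<one>\<^bsub>brace_top_ab (brace_quot A I)\<^esub>"
  shows "x \<in> M"
proof -
  let ?q = "\<lambda>x. I #>\<^bsub>add_monoid A\<^esub> x"
  interpret I: normal I "add_monoid A"
    by (rule add_normal[OF I])
  interpret Q: skew_left_brace "brace_quot A I"
    by (rule skew_left_brace_quot[OF I])
  have q: "group_hom (add_monoid A) (add_monoid (brace_quot A I)) ?q"
    unfolding group_hom_def group_hom_axioms_def add_monoid_quot[OF I]
    using add_group I.factorgroup_is_group I.r_coset_hom_Mod by blast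
  have "subgroup (?q ` M) (add_monoid (brace_quot A I))"
    by (rule group_hom.subgroup_img_is_subgroup[OF q ideal_add_subgroup[OF M(1)]])
  moreover have "commutative_modulo (brace_quot A I) (?q ` M)"
    unfolding commutative_modulo_def carrier_quot[OF I]
    using M(3) by (simp add: commutative_modulo_def quot_star[OF I] quot_add[OF I] quot_minus[OF I])
  moreover have "?q x \<in> carrier (brace_quot A I)"
    using x(1) by (simp add: carrier_quot[OF I])
  ultimately have "?q x \<in> ?q ` M"
    using x(2) by (rule Q.mem_if_top_ab_map_one)
  then show ?thesis
    using I.mem_if_rcos_mem_image[OF ideal_add_subgroup[OF M(1)] M(2)] x(1) by simp
qed

end

theorem theorem4p6:
  fixes A :: "('a, 'm) ring_scheme" and B :: "'a set ring"
  assumes "skew_left_brace A"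
    and "brace_Artinian A"
    and "brace_finite_weight A"
    and "B = brace_quot A (brace_Rad A)"
  shows "brace_weight A = brace_weight (trivial_brace (brace_top_ab B))
    \<and> (cyclic_group (brace_top_ab B) \<longrightarrow> brace_weight A = 1)
    \<and> (finite (carrier A) \<and> squarefree (card (carrier A))
        \<longrightarrow> cyclic_group (brace_top_ab B) \<and> brace_weight A = 1)"
proof -
  interpret skew_left_brace A
    by fact
  interpret E: brace_epi_comm_group A "brace_top_ab B"
    "\<lambda>x. top_ab_map B (brace_Rad A #>\<^bsub>add_monoid A\<^esub> x)"
    unfolding assms(4) by (rule top_ab_map_quot_epi[OF brace_ideal_Rad])
  have "brace_weight A = brace_weight (trivial_brace (brace_top_ab B))"
  proof (rule E.brace_weight_eq[OF assms(2,3)])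
    \<comment> \<open>Every maximal ideal contains the radical, so commutativity modulo
      \<open>M\<close> can be tested in the quotient \<open>B\<close>.\<close>
    fix M assume "maximal_brace_ideal M A" "commutative_modulo A M"
    then show "{x \<in> carrier A. top_ab_map B (brace_Rad A #>\<^bsub>add_monoid A\<^esub> x) = \<one>\<^bsub>brace_top_ab B\<^esub>} \<subseteq> M"
      unfolding assms(4)
      using mem_if_top_ab_map_quot_one[OF brace_ideal_Rad maximal_brace_idealD(1) brace_Rad_subset]
      by blast
  qed
  then show ?thesis
    using E.brace_weight_cyclic E.cyclic_group_if_squarefree assms(3) by simp
qed

end
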